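(* A scenario $S$ uniquely determines a pair of integers $A_M$ and $B_M$, with $A_M$ even and $B_M$ odd, and a pair of integers $A_N$ and $B_N$, with $A_N$ even and $B_N$ odd, such that for any $k = 1, 2, 3, \dots$, $M_k = A_M\cdot k - B_M$ is the startnumber and $N_k = A_N\cdot k - B_N$ is the endnumber of the Collatz sequence described by the scenario.
   Context: Collatz operations on positive integers: "u" (up) is $m \mapsto 3m+1$, applied when $m$ is odd; "d" (down) is $m\mapsto m/2$, applied when $m$ is even; "s" (spike) is u followed by d, i.e. $m\mapsto (3m+1)/2$, applied when $m$ is odd. A scenario is a sequence of Collatz operations connecting two odd integers; it is described by a finite word beginning with s and followed by any combination of the letters s and d, the operations being performed from left to right. A series of integers described by a given scenario is called a realization of the scenario: it starts with an odd positive integer (the startnumber), is obtained by performing successively the operations spelled out by the word, with s applied only to odd integers and d only to even integers, and ends with an odd integer (the endnumber). *)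

theory Defs
  imports Main
begin

definition up :: "int \<Rightarrow> int" where
  "up m = 3 * m + 1"

definition down :: "int \<Rightarrow> int" where
  "down m = m div 2"

datatype letter = Spike | Down

fun applicable :: "letter \<Rightarrow> int \<Rightarrow> bool" where
  "applicable Spike m = odd m"
| "applicable Down m = even m"

fun perform :: "letter \<Rightarrow> int \<Rightarrow> int" where
  "perform Spike m = down (up m)"
| "perform Down m = down m"

definition scenario :: "letter list \<Rightarrow> bool" where
  "scenario S \<longleftrightarrow> S \<noteq> [] \<and> hd S = Spike"

text \<open>A realization lists the integers before and after each letter, so the intermediate
  even value \<open>3 * m + 1\<close> inside a spike is not recorded. The startnumber and the endnumber
  are the head and the last element of the list.\<close>

definition realization :: "letter list \<Rightarrow> int list \<Rightarrow> bool" where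
  "realization S xs \<longleftrightarrow>
     length xs = Suc (length S) \<and>
     0 < hd xs \<and> odd (hd xs) \<and> odd (last xs) \<and>
     (\<forall>i < length S. applicable (S ! i) (xs ! i) \<and> xs ! Suc i = perform (S ! i) (xs ! i))"

text \<open>The realizations are parametrized by \<open>k = 1, 2, 3, \<dots>\<close>. The second
  quantified clause says that every realization is obtained; without it a subprogression (replace
  \<open>k\<close> by \<open>2 * k\<close> or \<open>k + 1\<close>) would also qualify, and the coefficients would not be unique.\<close>

definition parametrizes_realizations ::
    "letter list \<Rightarrow> int \<Rightarrow> int \<Rightarrow> int \<Rightarrow> int \<Rightarrow> bool" where
  "parametrizes_realizations S A_M B_M A_N B_N \<longleftrightarrow>
     (\<forall>k \<ge> 1. \<exists>xs. realization S xs \<and> hd xs = A_M * k - B_M \<and> last xs = A_N * k - B_N) \<and>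
     (\<forall>xs. realization S xs \<longrightarrow>
        (\<exists>k \<ge> 1. hd xs = A_M * k - B_M \<and> last xs = A_N * k - B_N))"

end

(* Reading the word from right to left, the startnumbers form a residue class A j + b with A coprime
   to 3, and the endnumbers depend affinely on j: a letter d doubles the class, and a letter s replaces
   it by the solutions m of 3 m + 1 = 2 (A j + b), which restricts j to one residue class modulo 3.
   Shifting j makes the positive startnumbers correspond to k >= 1. Uniqueness holds because an
   increasing progression is determined by its set of terms and the startnumber determines the
   endnumber. *)
theory Submission
  imports Defs
begin

text \<open>Only the two ends of a run are kept, so that induction on the word applies. Positivity
  and parity of the ends stay outside, since the tail of a scenario need not be a scenario.\<close>

fun reaches :: "letter list \<Rightarrow> int \<Rightarrow> int \<Rightarrow> bool" where
  "reaches [] m e \<longleftrightarrow> m = e"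
| "reaches (x # S) m e \<longleftrightarrow> applicable x m \<and> reaches S (perform x m) e"

lemma reaches_unique: "reaches S m e \<Longrightarrow> reaches S m e' \<Longrightarrow> e = e'"
  by (induction S arbitrary: m) auto

lemma reaches_iff_path:
  "reaches S m e \<longleftrightarrow> (\<exists>xs. length xs = Suc (length S) \<and> hd xs = m \<and> last xs = e \<and>
     (\<forall>i < length S. applicable (S ! i) (xs ! i) \<and> xs ! Suc i = perform (S ! i) (xs ! i)))"
proof (induction S arbitrary: m)
  case Nil
  show ?case
    by (auto simp: length_Suc_conv intro!: exI[of _ "[m]"])
next
  case (Cons x S)
  show ?case
  proof
    assume "reaches (x # S) m e"
    then obtain ys where x: "applicable x m" and ys: "length ys = Suc (length S)"
      "hd ys = perform x m" "last ys = e"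
      "\<forall>i < length S. applicable (S ! i) (ys ! i) \<and> ys ! Suc i = perform (S ! i) (ys ! i)"
      by (auto simp: Cons.IH)
    then have "ys ! 0 = perform x m"
      by (cases ys) auto
    with x ys show "\<exists>xs. length xs = Suc (length (x # S)) \<and> hd xs = m \<and> last xs = e \<and>
      (\<forall>i < length (x # S). applicable ((x # S) ! i) (xs ! i) \<and>
        xs ! Suc i = perform ((x # S) ! i) (xs ! i))"
      by (intro exI[of _ "m # ys"]) (auto simp: less_Suc_eq_0_disj)
  next
    assume "\<exists>xs. length xs = Suc (length (x # S)) \<and> hd xs = m \<and> last xs = e \<and>
      (\<forall>i < length (x # S). applicable ((x # S) ! i) (xs ! i) \<and>
        xs ! Suc i = perform ((x # S) ! i) (xs ! i))"
    then obtain xs where xs: "length xs = Suc (length (x # S))" "hd xs = m" "last xs = e"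
      and step: "\<And>i. i < Suc (length S) \<Longrightarrow> applicable ((x # S) ! i) (xs ! i) \<and>
        xs ! Suc i = perform ((x # S) ! i) (xs ! i)"
      by auto
    from xs obtain ys where xs_eq: "xs = m # ys" by (cases xs) auto
    have ys: "length ys = Suc (length S)" "last (m # ys) = e"
      using xs xs_eq by auto
    have "ys \<noteq> []" using ys by auto
    moreover have "applicable x m" "ys ! 0 = perform x m"
      using step[of 0] xs_eq by auto
    moreover have "\<forall>i < length S. applicable (S ! i) (ys ! i) \<and> ys ! Suc i = perform (S ! i) (ys ! i)"
      using step[of "Suc i" for i] xs_eq by auto
    ultimately show "reaches (x # S) m e"
      using ys by (auto simp: Cons.IH hd_conv_nth intro!: exI[of _ ys])
  qed
qed

lemma realization_iff_reaches:
  "(\<exists>xs. realization S xs \<and> hd xs = m \<and> last xs = e) \<longleftrightarrow>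
     0 < m \<and> odd m \<and> odd e \<and> reaches S m e"
  unfolding realization_def reaches_iff_path by blast

text \<open>Both clauses concern only the ends of a realization, so together they say that two sets
  of pairs are equal.\<close>

lemma parametrizes_realizations_iff:
  "parametrizes_realizations S A B C D \<longleftrightarrow>
     (\<forall>m e. (0 < m \<and> odd m \<and> odd e \<and> reaches S m e) \<longleftrightarrow>
       (\<exists>k\<ge>1. m = A * k - B \<and> e = C * k - D))"
  unfolding parametrizes_realizations_def realization_iff_reaches[symmetric] by blast

lemma reaches_affine:
  "\<exists>A b C c :: int. 0 < A \<and> \<not> 3 dvd A \<and>
     (\<forall>m e. (reaches S m e \<and> odd e) \<longleftrightarrow> (\<exists>j. m = A * j + b \<and> e = C * j + c))"
proof (induction S)
  case Nil
  show ?case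
    \<comment> \<open>Each witness serves twice: \<open>A\<close> and \<open>C\<close> are 2,
      \<open>b\<close> and \<open>c\<close> are 1, as the empty word relates every odd integer to
      itself.\<close>
    by (intro exI[of _ 2] exI[of _ 1]) (auto elim: oddE)
next
  case (Cons x S)
  then obtain A b C c :: int where A: "0 < A" "\<not> 3 dvd A" and
    S: "\<forall>m e. (reaches S m e \<and> odd e) \<longleftrightarrow> (\<exists>j. m = A * j + b \<and> e = C * j + c)"
    by (elim exE conjE) (rule that)
  show ?case
  proof (cases x)
    case Down
    have "(reaches (x # S) m e \<and> odd e) \<longleftrightarrow> (\<exists>j. m = 2 * A * j + 2 * b \<and> e = C * j + c)" for m e
    proof -
      have "(reaches (x # S) m e \<and> odd e) \<longleftrightarrow> even m \<and> (\<exists>j. m div 2 = A * j + b \<and> e = C * j + c)"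
        using S[rule_format, of "m div 2" e] by (auto simp: Down down_def)
      also have "\<dots> \<longleftrightarrow> (\<exists>j. m = 2 * (A * j + b) \<and> e = C * j + c)"
      proof -
        have "even m \<and> m div 2 = y \<longleftrightarrow> m = 2 * y" for y by auto
        then show ?thesis by blast
      qed
      finally show ?thesis by (simp add: algebra_simps)
    qed
    moreover have "\<not> 3 dvd 2 * A" using A by presburger
    ultimately show ?thesis using A(1)
      by (intro exI[of _ "2 * A"] exI[of _ "2 * b"] exI[of _ C] exI[of _ c]) auto
  next
    case Spike
    \<comment> \<open>As \<open>2 * A\<close> is invertible modulo 3, one residue \<open>r\<close>
      of \<open>j\<close> makes \<open>(2 * (A * j + b) - 1) / 3\<close> an integer;
      \<open>b'\<close> is its value at \<open>j = r\<close>.\<close>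
    have "\<exists>r. 3 dvd 2 * A * r + 2 * b - 1"
    proof -
      have "3 dvd 2 * A * 0 + 2 * b - 1 \<or> 3 dvd 2 * A * 1 + 2 * b - 1 \<or> 3 dvd 2 * A * 2 + 2 * b - 1"
        using A(2) by presburger
      then show ?thesis by blast
    qed
    then obtain r b' where r: "2 * A * r + 2 * b - 1 = 3 * b'"
      by (auto elim: dvdE)
    have *: "3 * m + 1 = 2 * (A * j + b) \<longleftrightarrow> (\<exists>i. j = 3 * i + r \<and> m = 2 * A * i + b')" for m j
    proof
      assume m: "3 * m + 1 = 2 * (A * j + b)"
      \<comment> \<open>Subtracting the particular solution \<open>m = b'\<close>,
        \<open>j = r\<close> leaves a homogeneous equation, which forces 3 to divide
        \<open>j - r\<close>.\<close>
      then have eq: "3 * (m - b') = 2 * (A * (j - r))"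
        using r by (simp add: algebra_simps)
      then have "3 dvd 2 * (A * (j - r))" by (metis dvd_triv_left)
      \<comment> \<open>Splitting off the residue of \<open>A\<close> turns the product into linear
        arithmetic with \<open>q * (j - r)\<close> as an atom.\<close>
      moreover have "\<exists>q. A = 3 * q + 1 \<or> A = 3 * q + 2"
        using A(2) by presburger
      then obtain q where "A = 3 * q + 1 \<or> A = 3 * q + 2" ..
      then have "A * (j - r) = 3 * (q * (j - r)) + (j - r) \<or>
          A * (j - r) = 3 * (q * (j - r)) + 2 * (j - r)"
        by (auto simp: algebra_simps)
      ultimately have "3 dvd j - r" by presburger
      then obtain i where i: "j - r = 3 * i" by (elim dvdE)
      with eq have "m = 2 * A * i + b'" by simp
      with i show "\<exists>i. j = 3 * i + r \<and> m = 2 * A * i + b'" by (intro exI[of _ i]) simp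
    next
      assume "\<exists>i. j = 3 * i + r \<and> m = 2 * A * i + b'"
      with r show "3 * m + 1 = 2 * (A * j + b)" by (auto simp: algebra_simps)
    qed
    have "(reaches (x # S) m e \<and> odd e) \<longleftrightarrow>
        (\<exists>i. m = 2 * A * i + b' \<and> e = 3 * C * i + (C * r + c))" for m e
    proof -
      have "(reaches (x # S) m e \<and> odd e) \<longleftrightarrow>
          odd m \<and> (\<exists>j. (3 * m + 1) div 2 = A * j + b \<and> e = C * j + c)"
        using S[rule_format, of "(3 * m + 1) div 2" e] by (auto simp: Spike down_def up_def)
      also have "\<dots> \<longleftrightarrow> (\<exists>j. 3 * m + 1 = 2 * (A * j + b) \<and> e = C * j + c)"
      proof -
        \<comment> \<open>The parity condition is absorbed: if \<open>3 * m + 1\<close> is even,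
          then \<open>m\<close> is odd.\<close>
        have "odd m \<and> (3 * m + 1) div 2 = y \<longleftrightarrow> 3 * m + 1 = 2 * y" for y by presburger
        then show ?thesis by blast
      qed
      also have "\<dots> \<longleftrightarrow> (\<exists>i. m = 2 * A * i + b' \<and> e = C * (3 * i + r) + c)"
        unfolding * by blast
      finally show ?thesis by (simp add: algebra_simps)
    qed
    moreover have "\<not> 3 dvd 2 * A" using A by presburger
    ultimately show ?thesis using A(1)
      by (intro exI[of _ "2 * A"] exI[of _ b'] exI[of _ "3 * C"] exI[of _ "C * r + c"]) auto
  qed
qed

lemma scenario_start_odd: "scenario S \<Longrightarrow> reaches S m e \<Longrightarrow> odd m"
  by (cases S) (auto simp: scenario_def)

lemma parametrizes_realizations_exists:
  assumes "scenario S"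
  shows "\<exists>A B C D. 0 < A \<and> even A \<and> odd B \<and> even C \<and> odd D \<and> parametrizes_realizations S A B C D"
proof -
  obtain A b C c :: int where A: "0 < A" and
    S: "\<forall>m e. (reaches S m e \<and> odd e) \<longleftrightarrow> (\<exists>j. m = A * j + b \<and> e = C * j + c)"
    using reaches_affine[of S] by (elim exE conjE) (rule that)
  have odd: "odd (A * j + b)" "odd (C * j + c)" for j
    using S[rule_format, of "A * j + b" "C * j + c"] scenario_start_odd[OF assms] by blast+
  \<comment> \<open>At \<open>j = 0\<close> the constants appear alone; at \<open>j = 1\<close>
    their oddness then forces even slopes.\<close>
  have "odd b" "odd c" using odd[of 0] by auto
  moreover from this have "even A" "even C" using odd[of 1] by auto
  \<comment> \<open>The floor of \<open>- b / A\<close> is the largest \<open>j\<close> with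
    \<open>A * j + b \<le> 0\<close>, so \<open>k = j - l\<close> gives the least positive
    startnumber the index 1.\<close>
  moreover define l where "l = (- b) div A"
  have pos: "0 < A * j + b \<longleftrightarrow> 1 \<le> j - l" for j
  proof -
    have "(- b + (- j) * A) div A = - j + l"
      using A unfolding l_def by (intro div_mult_self1) simp
    with pos_imp_zdiv_neg_iff[OF A, of "- b + (- j) * A"]
    have "- j + l < 0 \<longleftrightarrow> - b + (- j) * A < 0" by simp
    then show ?thesis by (auto simp: algebra_simps)
  qed
  have "parametrizes_realizations S A (- (A * l + b)) C (- (C * l + c))"
    unfolding parametrizes_realizations_iff
  proof (intro allI)
    fix m e
    have "(0 < m \<and> odd m \<and> odd e \<and> reaches S m e) \<longleftrightarrow>
        0 < m \<and> (\<exists>j. m = A * j + b \<and> e = C * j + c)"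
      using S[rule_format, of m e] scenario_start_odd[OF assms] by blast
    also have "\<dots> \<longleftrightarrow> (\<exists>j. 1 \<le> j - l \<and> m = A * j + b \<and> e = C * j + c)"
      using pos by blast
    also have "\<dots> \<longleftrightarrow> (\<exists>k. 1 \<le> k \<and> m = A * (k + l) + b \<and> e = C * (k + l) + c)"
      by (metis add_diff_cancel_right' diff_add_cancel)
    also have "\<dots> \<longleftrightarrow> (\<exists>k\<ge>1. m = A * k - (- (A * l + b)) \<and> e = C * k - (- (C * l + c)))"
      by (simp add: algebra_simps)
    finally show "(0 < m \<and> odd m \<and> odd e \<and> reaches S m e) \<longleftrightarrow>
      (\<exists>k\<ge>1. m = A * k - (- (A * l + b)) \<and> e = C * k - (- (C * l + c)))" .
  qed
  ultimately show ?thesis using A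
    by (intro exI[of _ A] exI[of _ "- (A * l + b)"] exI[of _ C] exI[of _ "- (C * l + c)"]) auto
qed

text \<open>The first term of one progression is a term of the other, whose least term is its
  first.\<close>

lemma progression_le:
  fixes A A' B B' :: int
  assumes "0 < A" "0 < A'"
    and sub: "\<And>k. 1 \<le> k \<Longrightarrow> \<exists>k'\<ge>1. A * k - B = A' * k' - B'"
  shows "A' - B' \<le> A - B"
proof -
  obtain k where "1 \<le> k" "A - B = A' * k - B'" using sub[of 1] by auto
  moreover have "A' * 1 \<le> A' * k" using \<open>0 < A'\<close> \<open>1 \<le> k\<close> by (intro mult_left_mono) auto
  ultimately show ?thesis by simp
qed

text \<open>With first terms equal, the second term of one progression shows that its slope is a
  multiple of the other slope.\<close>

lemma progression_step_le:
  fixes A A' B B' :: int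
  assumes "0 < A" "A - B = A' - B'"
    and sub: "\<And>k. 1 \<le> k \<Longrightarrow> \<exists>k'\<ge>1. A * k - B = A' * k' - B'"
  shows "A' \<le> A"
proof -
  obtain k where "1 \<le> k" "A * 2 - B = A' * k - B'" using sub[of 2] by auto
  with assms(2) have "A = A' * (k - 1)" by (simp add: algebra_simps)
  then have "A' dvd A" by simp
  with \<open>0 < A\<close> show ?thesis by (rule zdvd_imp_le[rotated])
qed

lemma progression_unique:
  fixes A A' B B' :: int
  assumes "0 < A" and pos: "\<And>k. 1 \<le> k \<Longrightarrow> 0 < A' * k - B'"
    and sub: "\<And>k. 1 \<le> k \<Longrightarrow> \<exists>k'\<ge>1. A * k - B = A' * k' - B'"
    and sup: "\<And>k. 1 \<le> k \<Longrightarrow> \<exists>k'\<ge>1. A' * k - B' = A * k' - B"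
  shows "A = A'" "B = B'"
proof -
  \<comment> \<open>The sign of \<open>A'\<close> has to be derived: slope 0 would identify the
    first two terms of the other progression, and a negative slope would produce negative
    terms.\<close>
  have "A' \<noteq> 0"
    using sub[of 1] sub[of 2] \<open>0 < A\<close> by auto
  moreover have "\<not> A' < 0"
  proof
    assume "A' < 0"
    \<comment> \<open>The index \<open>\<bar>B'\<bar> + 1\<close> is large enough for a slope of at
      most -1 to outweigh \<open>- B'\<close>.\<close>
    then have "A' * (\<bar>B'\<bar> + 1) \<le> - 1 * (\<bar>B'\<bar> + 1)" by (intro mult_right_mono) auto
    with pos[of "\<bar>B'\<bar> + 1"] show False by simp
  qed
  ultimately have "0 < A'" by simp
  have eq: "A - B = A' - B'"
    using progression_le[OF \<open>0 < A\<close> \<open>0 < A'\<close> sub] progression_le[OF \<open>0 < A'\<close> \<open>0 < A\<close> sup]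
    by simp
  show "A = A'"
    using progression_step_le[OF \<open>0 < A\<close> eq sub] progression_step_le[OF \<open>0 < A'\<close> eq[symmetric] sup]
    by simp
  with eq show "B = B'" by simp
qed

text \<open>Equal sets of startnumbers give \<open>A\<close> and \<open>B\<close>. Then equal
  \<open>k\<close> means equal startnumbers, hence equal endnumbers by
  \<open>reaches_unique\<close>, and the values at 1 and 2 fix \<open>C\<close> and
  \<open>D\<close>.\<close>

lemma parametrizes_realizations_unique:
  assumes "0 < A" and 1: "parametrizes_realizations S A B C D"
    and 2: "parametrizes_realizations S A' B' C' D'"
  shows "A' = A \<and> B' = B \<and> C' = C \<and> D' = D"
proof -
  have realize1: "reaches S (A * k - B) (C * k - D)" if "1 \<le> k" for k
    using 1 that unfolding parametrizes_realizations_iff by blast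
  have realize2: "0 < A' * k - B'" "reaches S (A' * k - B') (C' * k - D')" if "1 \<le> k" for k
    using 2 that unfolding parametrizes_realizations_iff by blast+
  have same: "(\<exists>k\<ge>1. m = A * k - B \<and> e = C * k - D) \<longleftrightarrow>
      (\<exists>k\<ge>1. m = A' * k - B' \<and> e = C' * k - D')" for m e
    using 1 2 unfolding parametrizes_realizations_iff by metis
  have AB: "A = A'" "B = B'"
    using progression_unique[OF \<open>0 < A\<close> realize2(1), of B] same by blast+
  have ends: "C * k - D = C' * k - D'" if "1 \<le> k" for k
    using reaches_unique realize1[OF that] realize2(2)[OF that] unfolding AB by blast
  have "C = C'" "D = D'"
    using ends[of 1] ends[of 2] by auto
  with AB show ?thesis by simp
qed

theorem proposition2p1:
  fixes S :: "letter list"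
  assumes "scenario S"
  shows "\<exists>!q. case q of (A_M :: int, B_M :: int, A_N :: int, B_N :: int) \<Rightarrow>
    even A_M \<and> odd B_M \<and> even A_N \<and> odd B_N \<and>
    parametrizes_realizations S A_M B_M A_N B_N"
proof -
  obtain A B C D where "0 < A" and "even A" "odd B" "even C" "odd D"
    and par: "parametrizes_realizations S A B C D"
    using parametrizes_realizations_exists[OF assms] by blast
  then show ?thesis
    by (intro ex1I[of _ "(A, B, C, D)"])
      (auto dest: parametrizes_realizations_unique[OF \<open>0 < A\<close> par])
qed

end
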